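(* For any $\varepsilon>0$ there is a positive integer $p(\varepsilon)$ such that for all even $p\ge p(\varepsilon)$ $$\mathcal{M}^{\mathrm{EM}}_p(\mathcal{S}_p\cap\mathbb{C}_{-,0})<\frac{(2.157+\varepsilon)^p}{\pi\sqrt{p-1}}.$$
   Context: Explicit midpoint (EM) extrapolation of even order $p\ge2$, $r=p/2$, on the test equation $U'=\lambda U$, with $z=\tau\lambda\in\mathbb{C}$ and internal perturbations: given $U_n$ and residuals $\tilde r_{m,j}\in\mathbb{C}$ ($1\le m\le r$, $1\le j\le2m$), set $$\widetilde Y_{m,0}=U_n,\quad \widetilde Y_{m,1}=\Big(1+\frac z{2m}\Big)\widetilde Y_{m,0}+\tilde r_{m,1},\quad \widetilde Y_{m,j}=\widetilde Y_{m,j-2}+\frac zm\widetilde Y_{m,j-1}+\tilde r_{m,j}\ (2\le j\le2m),\quad T_{m,1}=\widetilde Y_{m,2m},$$ $$T_{j,k}=T_{j,k-1}+\frac{T_{j,k-1}-T_{j-1,k-1}}{\frac{j^2}{(j-k+1)^2}-1}\quad(2\le k\le j\le r),\qquad U_{n+1}=T_{r,r}.$$ Then $U_{n+1}=P(z)U_n+\sum_{m=1}^r\sum_{\ell=1}^{2m}Q^{\mathrm{EM}}_{p,m,\ell}(z)\,\tilde r_{m,\ell}$, which defines the internal stability polynomials $Q^{\mathrm{EM}}_{p,m,\ell}$. For $\mathcal{S}\subset\mathbb{C}$, $$\mathcal{M}^{\mathrm{EM}}_p(\mathcal{S}):=\max_{1\le m\le r}\max_{1\le\ell\le2m}\sup_{z\in\mathcal{S}}|Q^{\mathrm{EM}}_{p,m,\ell}(z)|.$$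 The absolute stability region of the method is $\mathcal{S}_p=\{z\in\mathbb{C}:|\sum_{k=0}^pz^k/k!|\le1\}$, and $\mathbb{C}_{-,0}=\{z\in\mathbb{C}:\operatorname{Re}z\le0\}$. *)

theory Defs
  imports "HOL-Analysis.Analysis" "HOL-Computational_Algebra.Polynomial"
begin

text \<open>Explicit midpoint (EM) extrapolation applied to \<open>U' = \<lambda> U\<close>, with \<open>z = \<tau> \<lambda>\<close>, starting
  value \<open>u\<close> and residuals \<open>\<rho> m j\<close>. The order is \<open>p\<close>; the number of rows is \<open>p div 2\<close>.\<close>

fun em_stage :: "complex \<Rightarrow> complex \<Rightarrow> (nat \<Rightarrow> nat \<Rightarrow> complex) \<Rightarrow> nat \<Rightarrow> nat \<Rightarrow> complex" where
  "em_stage z u \<rho> m 0 = u"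
| "em_stage z u \<rho> m (Suc 0) = (1 + z / (2 * of_nat m)) * em_stage z u \<rho> m 0 + \<rho> m 1"
| "em_stage z u \<rho> m (Suc (Suc j)) =
     em_stage z u \<rho> m j + z / of_nat m * em_stage z u \<rho> m (Suc j) + \<rho> m (Suc (Suc j))"

text \<open>The table \<open>T j k\<close> is only meaningful for \<open>1 \<le> k \<le> j\<close>; in that range the natural number
  subtractions below are exact, and for \<open>2 \<le> k\<close> the denominator is nonzero.\<close>

fun em_table :: "complex \<Rightarrow> complex \<Rightarrow> (nat \<Rightarrow> nat \<Rightarrow> complex) \<Rightarrow> nat \<Rightarrow> nat \<Rightarrow> complex" where
  "em_table z u \<rho> j k =
     (if k \<le> 1 then em_stage z u \<rho> j (2 * j)
      else em_table z u \<rho> j (k - 1) +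
        (em_table z u \<rho> j (k - 1) - em_table z u \<rho> (j - 1) (k - 1)) /
          ((of_nat j)\<^sup>2 / (of_nat (j - k + 1))\<^sup>2 - 1))"

declare em_table.simps [simp del]

definition em_step :: "nat \<Rightarrow> complex \<Rightarrow> complex \<Rightarrow> (nat \<Rightarrow> nat \<Rightarrow> complex) \<Rightarrow> complex" where
  "em_step p z u \<rho> = em_table z u \<rho> (p div 2) (p div 2)"

definition em_expansion :: "nat \<Rightarrow> complex poly \<Rightarrow> (nat \<Rightarrow> nat \<Rightarrow> complex poly) \<Rightarrow> bool" where
  "em_expansion p P Q \<longleftrightarrow>
     (\<forall>z u \<rho>. em_step p z u \<rho> =
        poly P z * u + (\<Sum>m = 1..p div 2. \<Sum>l = 1..2 * m. poly (Q m l) z * \<rho> m l))"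

text \<open>The internal stability polynomials are the coefficients in the expansion above. For \<open>2 \<le> p\<close>,
  \<open>1 \<le> m \<le> p div 2\<close> and \<open>1 \<le> l \<le> 2 * m\<close> they exist and are unique; see the lemmas
  \<open>em_expansion_exists\<close>, \<open>em_expansion_unique\<close> and \<open>em_expansion_em_Q\<close>.\<close>

definition em_Q :: "nat \<Rightarrow> nat \<Rightarrow> nat \<Rightarrow> complex poly" where
  "em_Q p m l = (THE q. \<exists>P Q. em_expansion p P Q \<and> q = Q m l)"

text \<open>The supremum is taken in the extended reals, so that it is meaningful on unbounded sets.\<close>

definition em_M :: "nat \<Rightarrow> complex set \<Rightarrow> ereal" where
  "em_M p S =
     (MAX m\<in>{1..p div 2}. MAX l\<in>{1..2 * m}. SUP z\<in>S. ereal (cmod (poly (em_Q p m l) z)))"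

definition stability_region :: "nat \<Rightarrow> complex set" where
  "stability_region p = {z. cmod (\<Sum>k = 0..p. z ^ k / fact k) \<le> 1}"

definition left_half_plane :: "complex set" where
  "left_half_plane = {z. Re z \<le> 0}"


subsection \<open>Well-definedness of the internal stability polynomials\<close>

definition em_affine :: "nat \<Rightarrow> (complex \<Rightarrow> complex \<Rightarrow> (nat \<Rightarrow> nat \<Rightarrow> complex) \<Rightarrow> complex) \<Rightarrow> bool" where
  "em_affine r f \<longleftrightarrow>
     (\<exists>P Q. \<forall>z u \<rho>. f z u \<rho> =
        poly P z * u + (\<Sum>m = 1..r. \<Sum>l = 1..2 * m. poly (Q m l) z * \<rho> m l))"

lemma em_affine_start: "em_affine r (\<lambda>z u \<rho>. u)"
  unfolding em_affine_def
  by (rule exI[of _ 1], rule exI[of _ "\<lambda>_ _. 0"]) simp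

lemma sum_single_residual:
  fixes g :: "nat \<Rightarrow> nat \<Rightarrow> complex"
  assumes "1 \<le> m" "m \<le> r" "1 \<le> l" "l \<le> 2 * m"
  shows "(\<Sum>m' = 1..r. \<Sum>l' = 1..2 * m'. if m' = m \<and> l' = l then g m' l' else 0) = g m l"
proof -
  have "(\<Sum>l' = 1..2 * m'. if m' = m \<and> l' = l then g m' l' else 0) =
      (if m' = m then g m l else 0)" for m'
    using assms by (cases "m' = m") simp_all
  then show ?thesis
    using assms by simp
qed

lemma em_affine_residual:
  assumes "1 \<le> m" "m \<le> r" "1 \<le> l" "l \<le> 2 * m"
  shows "em_affine r (\<lambda>z u \<rho>. \<rho> m l)"
  unfolding em_affine_def
proof (rule exI[of _ 0], rule exI[of _ "\<lambda>m' l'. if m' = m \<and> l' = l then 1 else 0"], intro allI)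
  fix z u :: complex and \<rho> :: "nat \<Rightarrow> nat \<Rightarrow> complex"
  have "(\<Sum>m' = 1..r. \<Sum>l' = 1..2 * m'. poly (if m' = m \<and> l' = l then 1 else 0) z * \<rho> m' l') =
      (\<Sum>m' = 1..r. \<Sum>l' = 1..2 * m'. if m' = m \<and> l' = l then \<rho> m' l' else 0)"
    by (intro sum.cong refl) simp
  then show "\<rho> m l = poly 0 z * u +
      (\<Sum>m' = 1..r. \<Sum>l' = 1..2 * m'. poly (if m' = m \<and> l' = l then 1 else 0) z * \<rho> m' l')"
    using sum_single_residual[OF assms, of \<rho>] by simp
qed

lemma em_affine_add:
  assumes "em_affine r f" "em_affine r g"
  shows "em_affine r (\<lambda>z u \<rho>. f z u \<rho> + g z u \<rho>)"
proof -
  from assms obtain P Q P' Q' where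
    "\<And>z u \<rho>. f z u \<rho> = poly P z * u + (\<Sum>m = 1..r. \<Sum>l = 1..2 * m. poly (Q m l) z * \<rho> m l)"
    "\<And>z u \<rho>. g z u \<rho> = poly P' z * u + (\<Sum>m = 1..r. \<Sum>l = 1..2 * m. poly (Q' m l) z * \<rho> m l)"
    unfolding em_affine_def by blast
  then show ?thesis
    unfolding em_affine_def
    by (intro exI[of _ "P + P'"] exI[of _ "\<lambda>m l. Q m l + Q' m l"])
      (simp add: distrib_right sum.distrib)
qed

lemma em_affine_mult:
  assumes "em_affine r f" "\<And>z. c z = poly C z"
  shows "em_affine r (\<lambda>z u \<rho>. c z * f z u \<rho>)"
proof -
  from assms(1) obtain P Q where
    "\<And>z u \<rho>. f z u \<rho> = poly P z * u + (\<Sum>m = 1..r. \<Sum>l = 1..2 * m. poly (Q m l) z * \<rho> m l)"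
    unfolding em_affine_def by blast
  then show ?thesis
    unfolding em_affine_def
    by (intro exI[of _ "C * P"] exI[of _ "\<lambda>m l. C * Q m l"])
      (simp add: assms(2) distrib_left sum_distrib_left mult.assoc)
qed

lemma em_affine_stage:
  assumes "1 \<le> m" "m \<le> r" "j \<le> 2 * m"
  shows "em_affine r (\<lambda>z u \<rho>. em_stage z u \<rho> m j)"
  using assms(3)
proof (induction j rule: less_induct)
  case (less j)
  consider "j = 0" | "j = Suc 0" | i where "j = Suc (Suc i)"
    by (metis not0_implies_Suc)
  then show ?case
  proof cases
    case 1
    then show ?thesis by (simp add: em_affine_start)
  next
    case 2
    have "1 + z / (2 * of_nat m) = poly [:1, 1 / (2 * of_nat m):] z" for z :: complex
      by simp
    from em_affine_add[OF em_affine_mult[OF em_affine_start this] em_affine_residual[of m r 1]]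
    show ?thesis
      using 2 assms by simp
  next
    case 3
    have c: "z / of_nat m = poly [:0, 1 / of_nat m:] z" for z :: complex
      by simp
    have "em_affine r (\<lambda>z u \<rho>. em_stage z u \<rho> m i)" "em_affine r (\<lambda>z u \<rho>. em_stage z u \<rho> m (Suc i))"
      "em_affine r (\<lambda>z u \<rho>. \<rho> m (Suc (Suc i)))"
      using less 3 assms by (auto intro!: em_affine_residual)
    from em_affine_add[OF em_affine_add[OF this(1) em_affine_mult[OF this(2) c]] this(3)]
    show ?thesis
      using 3 by simp
  qed
qed

lemma em_affine_table:
  assumes "1 \<le> k" "k \<le> j" "j \<le> r"
  shows "em_affine r (\<lambda>z u \<rho>. em_table z u \<rho> j k)"
  using assms
proof (induction k arbitrary: j)
  case 0
  then show ?case by simp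
next
  case (Suc k)
  show ?case
  proof (cases "k = 0")
    case True
    then show ?thesis
      using Suc.prems em_affine_stage[of j r "2 * j"] by (simp add: em_table.simps)
  next
    case False
    define d :: complex where "d = (of_nat j)\<^sup>2 / (of_nat (j - Suc k + 1))\<^sup>2 - 1"
    have eq: "em_table z u \<rho> j (Suc k) =
        (1 + 1 / d) * em_table z u \<rho> j k + (- 1 / d) * em_table z u \<rho> (j - 1) k" for z u \<rho>
      using False
      by (subst em_table.simps) (simp add: d_def algebra_simps diff_divide_distrib)
    have "em_affine r (\<lambda>z u \<rho>. em_table z u \<rho> j k)"
      "em_affine r (\<lambda>z u \<rho>. em_table z u \<rho> (j - 1) k)"
      using False Suc.prems by (auto intro!: Suc.IH)
    from em_affine_add[OF em_affine_mult[OF this(1), of "\<lambda>_. 1 + 1 / d" "[:1 + 1 / d:]"]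
        em_affine_mult[OF this(2), of "\<lambda>_. - 1 / d" "[:- 1 / d:]"]]
    show ?thesis
      unfolding eq by simp
  qed
qed

lemma em_expansion_exists:
  assumes "2 \<le> p"
  shows "\<exists>P Q. em_expansion p P Q"
  using em_affine_table[of "p div 2" "p div 2" "p div 2"] assms
  by (simp add: em_affine_def em_expansion_def em_step_def)

lemma em_expansion_unit_residual:
  assumes "em_expansion p P Q" "1 \<le> m" "m \<le> p div 2" "1 \<le> l" "l \<le> 2 * m"
  shows "poly (Q m l) z = em_step p z 0 (\<lambda>m' l'. if m' = m \<and> l' = l then 1 else 0)"
proof -
  have "(\<Sum>m' = 1..p div 2. \<Sum>l' = 1..2 * m'.
        poly (Q m' l') z * (if m' = m \<and> l' = l then 1 else 0)) =
      (\<Sum>m' = 1..p div 2. \<Sum>l' = 1..2 * m'. if m' = m \<and> l' = l then poly (Q m' l') z else 0)"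
    by (intro sum.cong refl) simp
  with sum_single_residual[OF assms(2-5), of "\<lambda>m l. poly (Q m l) z"] show ?thesis
    using assms(1) by (simp add: em_expansion_def)
qed

lemma em_expansion_unique:
  assumes "em_expansion p P Q" "em_expansion p P' Q'"
    and "1 \<le> m" "m \<le> p div 2" "1 \<le> l" "l \<le> 2 * m"
  shows "Q m l = Q' m l"
proof -
  have "poly (Q m l) z = poly (Q' m l) z" for z
    using em_expansion_unit_residual[OF assms(1,3-6)] em_expansion_unit_residual[OF assms(2,3-6)]
    by simp
  then show ?thesis
    by (simp add: poly_eq_poly_eq_iff[symmetric] fun_eq_iff)
qed

lemma em_Q_eq:
  assumes "em_expansion p P Q" "1 \<le> m" "m \<le> p div 2" "1 \<le> l" "l \<le> 2 * m"
  shows "em_Q p m l = Q m l"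
  unfolding em_Q_def
  using em_expansion_unique[OF _ assms(1) assms(2-5)] assms(1)
  by (intro the_equality) blast+

lemma em_expansion_em_Q:
  assumes "2 \<le> p"
  shows "\<exists>P. em_expansion p P (em_Q p)"
proof -
  obtain P Q where PQ: "em_expansion p P Q"
    using em_expansion_exists[OF assms] by blast
  have "(\<Sum>m = 1..p div 2. \<Sum>l = 1..2 * m. poly (Q m l) z * \<rho> m l) =
      (\<Sum>m = 1..p div 2. \<Sum>l = 1..2 * m. poly (em_Q p m l) z * \<rho> m l)" for z \<rho>
    using em_Q_eq[OF PQ] by (intro sum.cong refl) auto
  then have "em_expansion p P (em_Q p)"
    using PQ by (simp add: em_expansion_def)
  then show ?thesis ..
qed

end

theory Submission
  imports Defs "HOL-Real_Asymp.Real_Asymp"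
begin

text \<open>
  Let \<open>r = p div 2\<close>. A unit residual in stage \<open>l\<close> of row \<open>m\<close> leaves all other rows at zero, and the
  extrapolation table is Lagrange interpolation in the squared step size, evaluated at step size
  zero. Hence \<open>Q p m l\<close> is the Lagrange weight of row \<open>m\<close> times the response of the midpoint
  recurrence in that row to the unit residual. Three factors depend on \<open>m\<close>, and each of them has a
  bound whose logarithm is affine in \<open>m\<close>:

  \<^item> The weight has modulus \<open>2 * (m ^ p / fact p) * (p choose (r + m))\<close>. One term of the exponential
    series gives \<open>m ^ p / fact p \<le> (x / 2) ^ p * exp (2 * m / x)\<close> for every \<open>x > 0\<close>.

  \<^item> One term of the binomial expansion of \<open>(exp \<tau> + exp (- \<tau>)) ^ p\<close> gives
    \<open>(p choose (r + m)) \<le> (2 * cosh \<tau>) ^ p * exp (- 2 * m * \<tau>)\<close> for every \<open>\<tau>\<close>.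

  \<^item> The recurrence grows at most by the factor \<open>exp v\<close> per stage, where \<open>2 * sinh v = \<bar>z\<bar> / m\<close>.
    Since \<open>sinh\<close> lies above its tangent at any \<open>w > 0\<close>, the \<open>2 * m\<close> stages together contribute at
    most \<open>exp (\<bar>z\<bar> / cosh w + 2 * m * (w - tanh w))\<close>.

  For \<open>\<tau> = w - tanh w + 1 / x\<close> the dependence on \<open>m\<close> cancels, and lemma \<open>norm_em_Q_le\<close> gives
  \<open>\<bar>Q p m l z\<bar> \<le> 2 * (x * cosh \<tau>) ^ p * exp (\<bar>z\<bar> / cosh w)\<close> uniformly in \<open>m\<close> and \<open>l\<close>.

  It remains to bound \<open>\<bar>z\<bar>\<close>. In the left half plane \<open>\<bar>exp z\<bar> \<le> 1\<close>, so a point of the stability region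
  has a Taylor remainder of modulus at most 2. For \<open>\<bar>z\<bar> \<le> 2 * p\<close> this remainder is comparable with
  \<open>z ^ (p + 1) / (fact p * (p + 1 - z))\<close>, which forces \<open>\<bar>z\<bar> ^ (p + 1) \<le> 12 * fact (p + 1)\<close>; larger \<open>z\<close>
  are excluded because the last term of the sum dominates there. So for each
  \<open>c > exp (- 1)\<close> the left half of the region is eventually contained in the disc of radius
  \<open>c * p\<close> (lemma \<open>eventually_stability_region_left_subset_cball\<close>).

  Altogether the maximum is at most \<open>2 * K ^ p\<close> with \<open>K = x * cosh \<tau> * exp (c / cosh w)\<close>. The values
  \<open>x = 5 / 6\<close>, \<open>w = ln (3 / 2)\<close>, \<open>c = 0.368\<close> are close to optimal and give \<open>K \<le> 2.157\<close>; the factor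
  \<open>2 * pi * sqrt (p - 1)\<close> is absorbed by \<open>\<epsilon>\<close>.
\<close>

section \<open>Extrapolation weights\<close>

text \<open>The Lagrange basis polynomial of node \<open>i\<close> for the nodes \<open>1 / i'\<^sup>2\<close>, \<open>i' \<in> I\<close>, evaluated at 0; the
  nodes are the squared step sizes up to a common factor.\<close>

definition em_weight :: "nat set \<Rightarrow> nat \<Rightarrow> complex" where
  "em_weight I i = (\<Prod>i'\<in>I - {i}. (of_nat i)\<^sup>2 / ((of_nat i)\<^sup>2 - (of_nat i')\<^sup>2))"

lemma of_nat_squares_neq:
  assumes "i \<noteq> j"
  shows "(of_nat i :: complex)\<^sup>2 - (of_nat j)\<^sup>2 \<noteq> 0"
proof -
  have "(of_nat i :: complex)\<^sup>2 - (of_nat j)\<^sup>2 = of_int ((int i)\<^sup>2 - (int j)\<^sup>2)"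
    by simp
  moreover have "(int i)\<^sup>2 - (int j)\<^sup>2 \<noteq> 0"
    using assms by (simp add: power2_eq_iff_nonneg)
  ultimately show ?thesis
    by (metis of_int_eq_0_iff)
qed

lemma em_weight_remove:
  assumes "finite I" "k \<in> I" "i \<in> I" "i \<noteq> k" "i > 0"
  shows "em_weight (I - {k}) i = em_weight I i * (((of_nat i)\<^sup>2 - (of_nat k)\<^sup>2) / (of_nat i)\<^sup>2)"
proof -
  let ?f = "\<lambda>i'. (of_nat i :: complex)\<^sup>2 / ((of_nat i)\<^sup>2 - (of_nat i')\<^sup>2)"
  have "em_weight I i = ?f k * (\<Prod>i'\<in>I - {i} - {k}. ?f i')"
    unfolding em_weight_def using assms by (intro prod.remove) auto
  also have "I - {i} - {k} = I - {k} - {i}"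
    by auto
  finally show ?thesis
    using of_nat_squares_neq[OF assms(4)] assms(5) unfolding em_weight_def
    by (simp add: field_simps)
qed

text \<open>Neville's recursion computes the value of the interpolation polynomial. Put both tables of the
  recursion over the common index set \<open>{j - k + 1..j}\<close>: the weight of row \<open>i\<close> is then multiplied by
  \<open>1 - a\<^sup>2 / i\<^sup>2\<close> and \<open>1 - j\<^sup>2 / i\<^sup>2\<close> respectively, where \<open>a\<close> is the first index, and
  \<open>j\<^sup>2 (i\<^sup>2 - a\<^sup>2) - a\<^sup>2 (i\<^sup>2 - j\<^sup>2) = i\<^sup>2 (j\<^sup>2 - a\<^sup>2)\<close>.\<close>

lemma em_table_eq_weighted_sum:
  assumes "1 \<le> k" "k \<le> j"
  shows "em_table z u \<rho> j k =
    (\<Sum>i\<in>{j - k + 1..j}. em_weight {j - k + 1..j} i * em_stage z u \<rho> i (2 * i))"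
  using assms
proof (induction k arbitrary: j rule: nat_induct_at_least)
  case base
  then show ?case
    by (simp add: em_table.simps em_weight_def)
next
  case (Suc k)
  define a where "a = j - k"
  have a: "1 \<le> a" "a < j" and k: "k \<ge> 1" "k \<le> j - 1"
    using Suc by (auto simp: a_def)
  define I where "I = {a..j}"
  define y where "y i = em_stage z u \<rho> i (2 * i)" for i
  define A where "A = (of_nat a :: complex)\<^sup>2"
  define J where "J = (of_nat j :: complex)\<^sup>2"
  have JA: "J - A \<noteq> 0" and A: "A \<noteq> 0"
    using of_nat_squares_neq[of j a] a by (auto simp: A_def J_def)
  \<comment> \<open>The index \<open>l\<close> may be kept in the sum because its new weight has the factor \<open>l\<^sup>2 - l\<^sup>2\<close>.\<close>
  have sum_remove: "(\<Sum>i\<in>I - {l}. em_weight (I - {l}) i * y i) =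
      (\<Sum>i\<in>I. em_weight I i * (((of_nat i)\<^sup>2 - (of_nat l)\<^sup>2) / (of_nat i)\<^sup>2) * y i)"
    if "l \<in> I" for l
  proof -
    have "(\<Sum>i\<in>I. em_weight I i * (((of_nat i)\<^sup>2 - (of_nat l)\<^sup>2) / (of_nat i)\<^sup>2) * y i) =
        (\<Sum>i\<in>I - {l}. em_weight I i * (((of_nat i)\<^sup>2 - (of_nat l)\<^sup>2) / (of_nat i)\<^sup>2) * y i)"
      using that by (subst sum.remove[of I l]) (auto simp: I_def)
    also have "\<dots> = (\<Sum>i\<in>I - {l}. em_weight (I - {l}) i * y i)"
      using that a by (intro sum.cong refl, subst em_weight_remove) (auto simp: I_def)
    finally show ?thesis ..
  qed
  have "em_table z u \<rho> j k = (\<Sum>i\<in>I - {a}. em_weight (I - {a}) i * y i)"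
  proof -
    have "{j - k + 1..j} = I - {a}"
      using a by (auto simp: I_def a_def)
    then show ?thesis
      using Suc.IH[of j] k unfolding y_def by simp
  qed
  moreover have "em_table z u \<rho> (j - 1) k = (\<Sum>i\<in>I - {j}. em_weight (I - {j}) i * y i)"
  proof -
    have "{j - 1 - k + 1..j - 1} = I - {j}"
      using a k by (auto simp: I_def a_def)
    then show ?thesis
      using Suc.IH[of "j - 1"] k unfolding y_def by simp
  qed
  ultimately have T:
    "em_table z u \<rho> j k = (\<Sum>i\<in>I. em_weight I i * (((of_nat i)\<^sup>2 - A) / (of_nat i)\<^sup>2) * y i)"
    "em_table z u \<rho> (j - 1) k = (\<Sum>i\<in>I. em_weight I i * (((of_nat i)\<^sup>2 - J) / (of_nat i)\<^sup>2) * y i)"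
    using sum_remove[of a] sum_remove[of j] a unfolding A_def J_def by (auto simp: I_def)
  have "em_table z u \<rho> j (Suc k) = em_table z u \<rho> j k +
      (em_table z u \<rho> j k - em_table z u \<rho> (j - 1) k) / (J / A - 1)"
    using k a by (subst em_table.simps) (simp add: A_def J_def a_def Suc_diff_Suc)
  also have "\<dots> = (J * em_table z u \<rho> j k - A * em_table z u \<rho> (j - 1) k) / (J - A)"
    using A JA by (simp add: field_simps)
  also have "\<dots> = (\<Sum>i\<in>I. (J * (em_weight I i * (((of_nat i)\<^sup>2 - A) / (of_nat i)\<^sup>2) * y i) -
      A * (em_weight I i * (((of_nat i)\<^sup>2 - J) / (of_nat i)\<^sup>2) * y i)) / (J - A))"
    unfolding T by (simp only: sum_distrib_left sum_subtractf sum_divide_distrib[symmetric])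
  also have "\<dots> = (\<Sum>i\<in>I. em_weight I i * y i)"
  proof (rule sum.cong)
    fix i assume "i \<in> I"
    then have i: "(of_nat i :: complex)\<^sup>2 \<noteq> 0"
      using a by (simp add: I_def)
    have "J * (w * (((of_nat i)\<^sup>2 - A) / (of_nat i)\<^sup>2) * y i) -
        A * (w * (((of_nat i)\<^sup>2 - J) / (of_nat i)\<^sup>2) * y i) = w * y i * (J - A)" for w
      using i by (simp add: field_simps)
    then show "(J * (em_weight I i * (((of_nat i)\<^sup>2 - A) / (of_nat i)\<^sup>2) * y i) -
        A * (em_weight I i * (((of_nat i)\<^sup>2 - J) / (of_nat i)\<^sup>2) * y i)) / (J - A) = em_weight I i * y i"
      using JA by simp
  qed simp
  finally show ?case
    using a by (simp add: I_def y_def a_def Suc_diff_Suc)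
qed

lemma prod_square_diffs_below:
  assumes "k < m"
  shows "(\<Prod>i=1..k. (real m)\<^sup>2 - (real i)\<^sup>2) * real m * fact (m - k - 1) = fact (m + k)"
  using assms
proof (induction k)
  case 0
  then show ?case
    by (simp add: fact_reduce)
next
  case (Suc k)
  then obtain d where d: "m = Suc (Suc k) + d"
    by (metis add.commute less_iff_Suc_add add_Suc_right add_Suc)
  have IH: "(\<Prod>i=1..k. (real m)\<^sup>2 - (real i)\<^sup>2) * real m * fact (Suc d) = fact (m + k)"
    using Suc d by simp
  have "(real m)\<^sup>2 - (real (Suc k))\<^sup>2 = real (Suc d) * real (m + Suc k)"
    by (simp add: d power2_eq_square algebra_simps)
  then have "(\<Prod>i=1..Suc k. (real m)\<^sup>2 - (real i)\<^sup>2) * real m * fact (m - Suc k - 1) =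
      ((\<Prod>i=1..k. (real m)\<^sup>2 - (real i)\<^sup>2) * real m * (real (Suc d) * fact d)) * real (m + Suc k)"
    by (simp add: d algebra_simps del: of_nat_Suc of_nat_add)
  also have "\<dots> = fact (m + k) * real (m + Suc k)"
    using IH by simp
  finally show ?case
    by (simp add: algebra_simps)
qed

text \<open>Each difference factors as \<open>\<bar>m - i\<bar> * (m + i)\<close>. The factors \<open>\<bar>m - i\<bar>\<close> contribute
  \<open>(m - 1)! (r - m)!\<close>, the factors \<open>m + i\<close> contribute \<open>(r + m)! / m!\<close> without the number \<open>2 * m\<close>,
  so \<open>m * (2 * m)\<close> is what the product lacks.\<close>

lemma prod_square_diffs:
  assumes "1 \<le> m" "m \<le> r"
  shows "(\<Prod>i\<in>{1..r} - {m}. \<bar>(real m)\<^sup>2 - (real i)\<^sup>2\<bar>) * (2 * (real m)\<^sup>2) =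
    fact (r - m) * fact (r + m)"
  using assms(2)
proof (induction r rule: dec_induct)
  case base
  have "{1..m} - {m} = {1..m - 1}"
    using assms by auto
  moreover have "(\<Prod>i=1..m - 1. \<bar>(real m)\<^sup>2 - (real i)\<^sup>2\<bar>) = (\<Prod>i=1..m - 1. (real m)\<^sup>2 - (real i)\<^sup>2)"
    using assms by (intro prod.cong refl abs_of_nonneg) (auto intro!: power_mono)
  moreover have "(\<Prod>i=1..m - 1. (real m)\<^sup>2 - (real i)\<^sup>2) * real m = fact (2 * m - 1)"
    using prod_square_diffs_below[of "m - 1" m] assms by (simp add: mult_2)
  moreover have "(fact (m + m) :: real) = fact (2 * m - 1) * (2 * real m)"
  proof -
    have "m + m = Suc (2 * m - 1)"
      using assms by simp
    then show ?thesis
      using assms by (simp only: fact_Suc) (simp add: of_nat_diff)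
  qed
  ultimately show ?case
    by (simp add: power2_eq_square)
next
  case (step r)
  have "{1..Suc r} - {m} = insert (Suc r) ({1..r} - {m})"
    using step assms by auto
  then have "(\<Prod>i\<in>{1..Suc r} - {m}. \<bar>(real m)\<^sup>2 - (real i)\<^sup>2\<bar>) =
      \<bar>(real m)\<^sup>2 - (real (Suc r))\<^sup>2\<bar> * (\<Prod>i\<in>{1..r} - {m}. \<bar>(real m)\<^sup>2 - (real i)\<^sup>2\<bar>)"
    by (simp del: of_nat_Suc)
  moreover have "\<bar>(real m)\<^sup>2 - (real (Suc r))\<^sup>2\<bar> = real (Suc r - m) * real (Suc r + m)"
  proof -
    have "(real m)\<^sup>2 \<le> (real (Suc r))\<^sup>2"
      using step by (intro power_mono) auto
    then show ?thesis
      using step by (simp add: of_nat_diff power2_eq_square algebra_simps)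
  qed
  moreover have "(fact (Suc r - m) :: real) = real (Suc r - m) * fact (r - m)"
    using step by (simp add: Suc_diff_le)
  moreover have "(fact (Suc r + m) :: real) = real (Suc r + m) * fact (r + m)"
    by simp
  ultimately show ?case
    using step.IH by algebra
qed

lemma norm_em_weight:
  assumes "1 \<le> m" "m \<le> r"
  shows "cmod (em_weight {1..r} m) = 2 * real m ^ (2 * r) / (fact (r - m) * fact (r + m))"
proof -
  have *: "cmod ((of_nat m)\<^sup>2 - (of_nat i)\<^sup>2) = \<bar>(real m)\<^sup>2 - (real i)\<^sup>2\<bar>" for i
  proof -
    have "(of_nat m)\<^sup>2 - (of_nat i)\<^sup>2 = complex_of_real ((real m)\<^sup>2 - (real i)\<^sup>2)"
      by simp
    then show ?thesis
      by (simp only: norm_of_real)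
  qed
  have "cmod (em_weight {1..r} m) = (\<Prod>i\<in>{1..r} - {m}. (real m)\<^sup>2 / \<bar>(real m)\<^sup>2 - (real i)\<^sup>2\<bar>)"
    by (simp add: em_weight_def prod_norm[symmetric] norm_divide norm_power *)
  also have "\<dots> = ((real m)\<^sup>2) ^ (r - 1) / (\<Prod>i\<in>{1..r} - {m}. \<bar>(real m)\<^sup>2 - (real i)\<^sup>2\<bar>)"
    using assms by (simp add: prod_dividef card_Diff_singleton)
  also have "\<dots> = (((real m)\<^sup>2) ^ (r - 1) * (2 * (real m)\<^sup>2)) / (fact (r - m) * fact (r + m))"
    using assms unfolding prod_square_diffs[OF assms, symmetric] by simp
  also have "((real m)\<^sup>2) ^ (r - 1) * (2 * (real m)\<^sup>2) = 2 * ((real m)\<^sup>2) ^ Suc (r - 1)"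
    by simp
  also have "\<dots> = 2 * real m ^ (2 * r)"
    using assms by (simp add: power_mult)
  finally show ?thesis .
qed

section \<open>Propagation of a unit residual\<close>

lemma em_stage_before_residual:
  assumes "\<And>i. i \<le> j \<Longrightarrow> \<rho> m i = 0"
  shows "em_stage z 0 \<rho> m j = 0"
  using assms
proof (induction j rule: induct_nat_012)
  case (ge2 j)
  then have "em_stage z 0 \<rho> m j = 0" "em_stage z 0 \<rho> m (Suc j) = 0" "\<rho> m (Suc (Suc j)) = 0"
    by (meson le_SucI order_refl)+
  then show ?case
    by simp
qed simp_all

text \<open>The number \<open>exp v\<close> is the positive root of \<open>t\<^sup>2 = 1 + 2 * sinh v * t\<close>, the characteristic equation
  of the midpoint recurrence with \<open>2 * sinh v\<close> in place of \<open>z / m\<close>.\<close>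

lemma norm_em_stage_unit_residual:
  assumes "0 \<le> v" "cmod z / real m \<le> 2 * sinh v"
  shows "cmod (em_stage z 0 (\<lambda>m' l'. if m' = m \<and> l' = l then 1 else 0) m j) \<le> exp (v * real j)"
proof (induction j rule: induct_nat_012)
  case 0
  then show ?case by simp
next
  case 1
  then show ?case using assms by simp
next
  case (ge2 j)
  let ?y = "em_stage z 0 (\<lambda>m' l'. if m' = m \<and> l' = l then 1 else 0) m"
  \<comment> \<open>When the residual enters, both previous stages still vanish, so it is never added to a
    nonzero response.\<close>
  show ?case
  proof (cases "l = Suc (Suc j)")
    case True
    then have "?y j = 0" "?y (Suc j) = 0"
      by (auto intro!: em_stage_before_residual)
    then show ?thesis
      using True assms by simp
  next
    case False
    have "cmod (?y (Suc (Suc j))) \<le> cmod (?y j) + cmod z / real m * cmod (?y (Suc j))"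
      using False norm_triangle_ineq[of "?y j" "z / of_nat m * ?y (Suc j)"]
      by (simp add: norm_mult norm_divide)
    also have "\<dots> \<le> exp (v * real j) + 2 * sinh v * exp (v * real (Suc j))"
      using ge2 assms by (intro add_mono mult_mono) auto
    also have "\<dots> = exp (v * real (Suc (Suc j)))"
      using exp_add[of v v] by (simp add: sinh_def exp_add exp_minus field_simps)
    finally show ?thesis .
  qed
qed

lemma sinh_above_tangent:
  fixes v w :: real
  assumes "0 \<le> v" "0 < w"
  shows "sinh v \<ge> sinh w + cosh w * (v - w)"
proof -
  have "convex_on {0..} (sinh :: real \<Rightarrow> real)"
    by (rule f''_ge0_imp_convex[where f' = cosh and f'' = sinh])
      (auto intro!: derivative_eq_intros)
  then have "sinh v - sinh w \<ge> cosh w * (v - w)"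
    using assms
    by (intro convex_on_imp_above_tangent[of "{0..}"])
      (auto intro!: derivative_eq_intros)
  then show ?thesis by simp
qed

text \<open>The best rate is \<open>v = arsinh (\<bar>z\<bar> / (2 * m))\<close>. Its tangent at \<open>sinh w\<close> is a larger, hence
  admissible, rate, and it makes the exponent affine in \<open>m\<close>.\<close>

lemma norm_em_stage_le_exp:
  assumes "0 < w" "1 \<le> m"
  shows "cmod (em_stage z 0 (\<lambda>m' l'. if m' = m \<and> l' = l then 1 else 0) m (2 * m)) \<le>
    exp (cmod z / cosh w + 2 * real m * (w - tanh w))"
proof -
  define s where "s = cmod z / real m"
  define v where "v = w + (s / 2 - sinh w) / cosh w"
  have c: "cosh w > 0"
    by simp
  have "tanh w \<le> w"
    using sinh_above_tangent[of 0 w] assms c by (simp add: tanh_def field_simps)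
  moreover have "s / 2 / cosh w \<ge> 0"
    by (simp add: s_def)
  ultimately have v: "v \<ge> 0"
    by (simp add: v_def tanh_def diff_divide_distrib)
  have "sinh w + cosh w * (v - w) = s / 2"
    using c by (simp add: v_def)
  with sinh_above_tangent[OF v assms(1)] have "cmod z / real m \<le> 2 * sinh v"
    by (simp add: s_def)
  from norm_em_stage_unit_residual[OF v this]
  have "cmod (em_stage z 0 (\<lambda>m' l'. if m' = m \<and> l' = l then 1 else 0) m (2 * m)) \<le>
      exp (v * real (2 * m))" .
  also have "v * real (2 * m) = cmod z / cosh w + 2 * real m * (w - tanh w)"
    using assms c by (simp add: v_def s_def tanh_def field_simps)
  finally show ?thesis .
qed

section \<open>A bound on the internal stability polynomials\<close>

lemma em_Q_eq_weight_stage: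
  assumes "1 \<le> m" "m \<le> r" "1 \<le> l" "l \<le> 2 * m"
  shows "poly (em_Q (2 * r) m l) z = em_weight {1..r} m *
    em_stage z 0 (\<lambda>m' l'. if m' = m \<and> l' = l then 1 else 0) m (2 * m)"
proof -
  let ?\<rho> = "\<lambda>m' l'. if m' = m \<and> l' = l then 1 else 0"
  obtain P where "em_expansion (2 * r) P (em_Q (2 * r))"
    using em_expansion_em_Q[of "2 * r"] assms by auto
  then have "poly (em_Q (2 * r) m l) z = em_table z 0 ?\<rho> r r"
    using em_expansion_unit_residual[of "2 * r" P "em_Q (2 * r)" m l z] assms
    by (simp add: em_step_def)
  also have "\<dots> = (\<Sum>i\<in>{1..r}. em_weight {1..r} i * em_stage z 0 ?\<rho> i (2 * i))"
    using assms by (subst em_table_eq_weighted_sum) auto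
  also have "\<dots> = (\<Sum>i\<in>{m}. em_weight {1..r} i * em_stage z 0 ?\<rho> i (2 * i))"
    using assms by (intro sum.mono_neutral_right) (auto intro!: em_stage_before_residual)
  finally show ?thesis
    by simp
qed

lemma binomial_exp_le:
  fixes \<tau> :: real
  assumes "m \<le> r"
  shows "real ((2 * r) choose (r + m)) * exp (2 * real m * \<tau>) \<le> (2 * cosh \<tau>) ^ (2 * r)"
proof -
  let ?f = "\<lambda>k. real ((2 * r) choose k) * exp \<tau> ^ k * exp (- \<tau>) ^ (2 * r - k)"
  have "exp \<tau> ^ (r + m) * exp (- \<tau>) ^ (2 * r - (r + m)) = exp (2 * real m * \<tau>)"
    using assms by (simp add: exp_of_nat_mult[symmetric] exp_add[symmetric] of_nat_diff algebra_simps)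
  then have "real ((2 * r) choose (r + m)) * exp (2 * real m * \<tau>) = ?f (r + m)"
    by (simp add: mult.assoc)
  also have "\<dots> \<le> (\<Sum>k\<le>2 * r. ?f k)"
    using assms by (intro member_le_sum) auto
  also have "\<dots> = (exp \<tau> + exp (- \<tau>)) ^ (2 * r)"
    by (simp add: binomial_ring)
  also have "exp \<tau> + exp (- \<tau>) = 2 * cosh \<tau>"
    by (simp add: cosh_def)
  finally show ?thesis .
qed

lemma power_div_fact_le_exp:
  fixes y :: real
  assumes "0 \<le> y"
  shows "y ^ n / fact n \<le> exp y"
proof -
  have "(\<Sum>k\<in>{n}. inverse (fact k) *\<^sub>R y ^ k) \<le> (\<Sum>k. inverse (fact k) *\<^sub>R y ^ k)"
    using assms by (intro sum_le_suminf summable_exp_generic) auto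
  then show ?thesis
    by (simp add: exp_def divide_inverse mult.commute)
qed

text \<open>The free parameters \<open>x\<close> and \<open>w\<close> fix the tangents at which the logarithms of the power and of the
  stage growth are linearised. The tilt \<open>\<tau>\<close> of the binomial distribution is chosen so that the three
  exponents that contain \<open>m\<close> add up to zero.\<close>

lemma norm_em_Q_le:
  assumes "0 < x" "0 < w" "1 \<le> m" "m \<le> r" "1 \<le> l" "l \<le> 2 * m"
  shows "cmod (poly (em_Q (2 * r) m l) z) \<le>
    2 * (x * cosh (w - tanh w + 1 / x)) ^ (2 * r) * exp (cmod z / cosh w)"
proof -
  define \<tau> where "\<tau> = w - tanh w + 1 / x"
  define B where "B = real ((2 * r) choose (r + m))"
  have "B = fact (2 * r) / (fact (r - m) * fact (r + m))"
    using assms(4) binomial_fact[of "r + m" "2 * r", where ?'a = real]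
    by (simp add: B_def mult.commute)
  then have w: "cmod (em_weight {1..r} m) = 2 * (real m ^ (2 * r) / fact (2 * r)) * B"
    using norm_em_weight[OF assms(3,4)] by simp
  have B: "B \<le> (2 * cosh \<tau>) ^ (2 * r) * exp (- (2 * real m * \<tau>))"
    using binomial_exp_le[OF assms(4), of \<tau>] by (simp add: B_def exp_minus field_simps)
  have "real m ^ (2 * r) / fact (2 * r) = (x / 2) ^ (2 * r) * ((2 * real m / x) ^ (2 * r) / fact (2 * r))"
    using assms by (simp add: power_mult_distrib[symmetric])
  also have "\<dots> \<le> (x / 2) ^ (2 * r) * exp (2 * real m / x)"
    using assms by (intro mult_left_mono power_div_fact_le_exp) auto
  finally have M: "real m ^ (2 * r) / fact (2 * r) \<le> (x / 2) ^ (2 * r) * exp (2 * real m / x)" .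
  have "cmod (poly (em_Q (2 * r) m l) z) \<le>
      2 * ((x / 2) ^ (2 * r) * exp (2 * real m / x)) * ((2 * cosh \<tau>) ^ (2 * r) * exp (- (2 * real m * \<tau>))) *
        exp (cmod z / cosh w + 2 * real m * (w - tanh w))"
    unfolding em_Q_eq_weight_stage[OF assms(3-6)] norm_mult w
    using assms M B by (intro mult_mono norm_em_stage_le_exp) (auto simp: B_def)
  also have "\<dots> = 2 * ((x / 2) ^ (2 * r) * (2 * cosh \<tau>) ^ (2 * r)) *
      (exp (2 * real m / x) * exp (- (2 * real m * \<tau>)) * exp (cmod z / cosh w + 2 * real m * (w - tanh w)))"
    by (simp only: ac_simps)
  also have "(x / 2) ^ (2 * r) * (2 * cosh \<tau>) ^ (2 * r) = (x * cosh \<tau>) ^ (2 * r)"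
    by (simp only: power_mult_distrib[symmetric]) simp
  also have "exp (2 * real m / x) * exp (- (2 * real m * \<tau>)) * exp (cmod z / cosh w + 2 * real m * (w - tanh w)) =
      exp (cmod z / cosh w)"
    by (simp add: exp_add[symmetric] \<tau>_def algebra_simps)
  finally show ?thesis
    by (simp add: \<tau>_def)
qed

section \<open>Size of the left half of the stability region\<close>

definition trunc_exp :: "nat \<Rightarrow> complex \<Rightarrow> complex" where
  "trunc_exp p z = (\<Sum>k\<le>p. z ^ k / fact k)"

lemma trunc_exp_Suc: "trunc_exp (Suc p) z = trunc_exp p z + z ^ Suc p / fact (Suc p)"
  by (simp add: trunc_exp_def)

lemma has_field_derivative_trunc_exp:
  "(trunc_exp p has_field_derivative trunc_exp p z - z ^ p / fact p) (at z)"
proof (induction p)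
  case 0
  then show ?case
    by (simp add: trunc_exp_def[abs_def])
next
  case (Suc p)
  have "((\<lambda>z. trunc_exp p z + z ^ Suc p / fact (Suc p)) has_field_derivative
      (trunc_exp p z - z ^ p / fact p) + of_nat (Suc p) * z ^ p / fact (Suc p)) (at z)"
    by (intro DERIV_add Suc DERIV_cdivide)
      (auto intro!: derivative_eq_intros simp del: power_Suc of_nat_Suc)
  also have "of_nat (Suc p) * z ^ p / fact (Suc p) = z ^ p / fact p"
    by (simp del: of_nat_Suc)
  finally show ?case
    by (simp add: trunc_exp_Suc[abs_def])
qed

lemma Re_nonpos_imp_le_norm_diff:
  assumes "Re z \<le> 0"
  shows "real n \<le> cmod (of_nat n - z)"
  using assms complex_Re_le_cmod[of "of_nat n - z"] by simp

text \<open>Repeated integration by parts of the Taylor remainder suggests the leading term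
  \<open>- w ^ n / (fact p * (n - w))\<close>. Let \<open>G\<close> be the partial sum minus this term. It satisfies
  \<open>G' = G + w ^ n / (fact p * (n - w)\<^sup>2)\<close>, which is the equation of \<open>exp\<close> up to a defect of lower
  order. Variation of constants along the segment from 0 to \<open>z\<close> turns the defect into the error
  bound; the half plane is used to bound \<open>exp ((1 - s) * z)\<close> by 1 and \<open>n - s * z\<close> from below.\<close>

lemma norm_trunc_exp_plus_leading_le:
  fixes p n :: nat
  assumes "Re z \<le> 0"
  defines "n \<equiv> Suc p"
  shows "cmod (trunc_exp p z + z ^ n / (fact p * (of_nat n - z))) \<le>
    1 + cmod z ^ Suc n / (fact p * (real n)\<^sup>2 * real (Suc n))"
proof -
  define G where "G w = trunc_exp p w + w ^ n / (fact p * (of_nat n - w))" for w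
  define F where "F s = exp ((1 - s) * z) * G (s * z)" for s
  define F' where "F' s = exp ((1 - s) * z) * (z * (s * z) ^ n / (fact p * (of_nat n - s * z)\<^sup>2))" for s
  define \<phi> where "\<phi> s = cmod z ^ Suc n / (fact p * (real n)\<^sup>2 * real (Suc n)) * s ^ Suc n" for s :: real
  define \<phi>' where "\<phi>' s = cmod z ^ Suc n / (fact p * (real n)\<^sup>2) * s ^ n" for s :: real
  have G: "(G has_field_derivative G w + w ^ n / (fact p * (of_nat n - w)\<^sup>2)) (at w)"
    if "of_nat n - w \<noteq> 0" for w
  proof -
    define d where "d = of_nat n - w"
    have d: "d \<noteq> 0"
      using that by (simp add: d_def)
    have "(G has_field_derivative
        (trunc_exp p w - w ^ p / fact p) +
        (of_nat n * w ^ p * (fact p * d) + w ^ n * fact p) / (fact p * d)\<^sup>2) (at w)"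
      using that unfolding G_def d_def n_def
      by (auto intro!: derivative_eq_intros has_field_derivative_trunc_exp
          simp: power2_eq_square simp del: power_Suc of_nat_Suc)
    also have "(trunc_exp p w - w ^ p / fact p) +
        (of_nat n * w ^ p * (fact p * d) + w ^ n * fact p) / (fact p * d)\<^sup>2 =
        trunc_exp p w + (w ^ p * (of_nat n - d) / (fact p * d) + w ^ n / (fact p * d\<^sup>2))"
      using d by (simp add: field_simps power2_eq_square)
    also have "w ^ p * (of_nat n - d) = w ^ n"
      by (simp add: d_def n_def)
    finally show ?thesis
      by (simp add: G_def[abs_def] d_def add.assoc)
  qed
  have nz: "of_nat n - complex_of_real s * z \<noteq> 0" and dist: "real n \<le> cmod (of_nat n - complex_of_real s * z)"
    if "0 \<le> s" for s
  proof -
    show "real n \<le> cmod (of_nat n - complex_of_real s * z)"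
      using assms that by (intro Re_nonpos_imp_le_norm_diff) (simp add: mult_nonneg_nonpos)
    then show "of_nat n - complex_of_real s * z \<noteq> 0"
      by (auto simp: n_def)
  qed
  have F: "((\<lambda>s. F (complex_of_real s)) has_vector_derivative F' s) (at s)" if "0 \<le> s" for s :: real
  proof (rule has_vector_derivative_real_field)
    let ?s = "complex_of_real s"
    have G_chain: "((\<lambda>s. G (s * z)) has_field_derivative
        (G (?s * z) + (?s * z) ^ n / (fact p * (of_nat n - ?s * z)\<^sup>2)) * z) (at ?s)"
      by (rule DERIV_chain2[where f = G and g = "\<lambda>s. s * z", OF G[OF nz[OF that]]])
        (auto intro!: derivative_eq_intros)
    have "(F has_field_derivative (exp ((1 - ?s) * z) * (- z)) * G (?s * z) +
        ((G (?s * z) + (?s * z) ^ n / (fact p * (of_nat n - ?s * z)\<^sup>2)) * z) * exp ((1 - ?s) * z)) (at ?s)"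
      unfolding F_def by (intro DERIV_mult G_chain) (auto intro!: derivative_eq_intros)
    also have "(exp ((1 - ?s) * z) * (- z)) * G (?s * z) +
        ((G (?s * z) + (?s * z) ^ n / (fact p * (of_nat n - ?s * z)\<^sup>2)) * z) * exp ((1 - ?s) * z) = F' ?s"
      by (simp add: F'_def algebra_simps)
    finally show "(F has_field_derivative F' ?s) (at ?s)" .
  qed
  have phi: "(\<phi> has_vector_derivative \<phi>' s) (at s)" for s
    unfolding has_real_derivative_iff_has_vector_derivative[symmetric] \<phi>_def \<phi>'_def
    using DERIV_cmult[OF DERIV_pow[of "Suc n" s UNIV],
        of "cmod z ^ Suc n / (fact p * (real n)\<^sup>2 * real (Suc n))"]
    by (simp del: power_Suc of_nat_Suc)
  have "cmod (F' (complex_of_real s)) \<le> \<phi>' s" if s: "0 < s" "s < 1" for s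
  proof -
    have "cmod (exp ((1 - complex_of_real s) * z)) \<le> 1"
      using s assms(1) by (simp add: mult_nonneg_nonpos)
    moreover have "cmod (z * (complex_of_real s * z) ^ n / (fact p * (of_nat n - complex_of_real s * z)\<^sup>2)) =
        cmod z * (s * cmod z) ^ n / (fact p * (cmod (of_nat n - complex_of_real s * z))\<^sup>2)"
      using s by (simp add: norm_mult norm_divide norm_power)
    moreover have "\<dots> \<le> cmod z * (s * cmod z) ^ n / (fact p * (real n)\<^sup>2)"
      using s dist[of s] by (intro divide_left_mono mult_left_mono power_mono mult_pos_pos)
        (auto simp: n_def)
    moreover have "\<dots> = \<phi>' s"
      by (simp add: \<phi>'_def power_mult_distrib)
    ultimately have "cmod (F' (complex_of_real s)) \<le> 1 * \<phi>' s"
      unfolding F'_def norm_mult[of "exp _"] by (intro mult_mono norm_ge_zero) auto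
    then show ?thesis
      by simp
  qed
  then have "cmod (F (complex_of_real 1) - F (complex_of_real 0)) \<le> \<phi> 1 - \<phi> 0"
    using F phi
    by (intro differentiable_bound_general[where f' = "\<lambda>s. F' (complex_of_real s)" and \<phi>' = \<phi>'])
      (auto intro!: continuous_at_imp_continuous_on has_vector_derivative_continuous)
  moreover have "F (complex_of_real 1) = G z" "F (complex_of_real 0) = exp z"
    by (simp_all add: F_def G_def n_def trunc_exp_def power_0_left if_distrib[of "\<lambda>x. x / _"] cong: if_cong)
  ultimately have "cmod (G z - exp z) \<le> \<phi> 1 - \<phi> 0"
    by (simp only:)
  moreover have "cmod (G z) \<le> cmod (G z - exp z) + cmod (exp z)"
    by (metis diff_add_cancel norm_triangle_ineq)
  moreover have "cmod (exp z) \<le> 1"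
    using assms(1) by simp
  ultimately have "cmod (G z) \<le> 1 + (\<phi> 1 - \<phi> 0)"
    by linarith
  then show ?thesis
    by (simp add: G_def \<phi>_def)
qed

text \<open>Successive terms of the sum at least double in modulus, so the last one dominates the others.\<close>

lemma norm_trunc_exp_gt_1:
  assumes "2 \<le> p" "2 * real p \<le> cmod z"
  shows "cmod (trunc_exp p z) > 1"
proof -
  define y where "y = cmod z"
  define b where "b k = y ^ k / fact k" for k
  have y: "2 * real p \<le> y" "0 < y"
    using assms by (auto simp: y_def)
  have terms_double: "b k \<le> b (Suc k) / 2" if "k < p" for k
  proof -
    have "2 * real (Suc k) \<le> y"
      using that y(1) by simp
    then have "y ^ k * (2 * real (Suc k)) \<le> y ^ k * y"
      using y by (intro mult_left_mono) auto
    then show ?thesis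
      by (simp add: b_def field_simps del: of_nat_Suc)
  qed
  have geom: "(\<Sum>k<i. b k) < b i - 1" if "1 \<le> i" "i \<le> p" for i
    using that
  proof (induction i rule: dec_induct)
    case base
    then show ?case
      using y assms by (simp add: b_def)
  next
    case (step i)
    have "(\<Sum>k<Suc i. b k) = (\<Sum>k<i. b k) + b i"
      by simp
    moreover have "(\<Sum>k<i. b k) < b i - 1"
      using step by simp
    moreover have "b i \<le> b (Suc i) / 2"
      using step by (intro terms_double) auto
    ultimately show ?case
      by linarith
  qed
  have "b p = cmod (trunc_exp p z - (\<Sum>k<p. z ^ k / fact k))"
    by (simp add: trunc_exp_def b_def y_def norm_divide norm_power lessThan_Suc_atMost[symmetric])
  also have "\<dots> \<le> cmod (trunc_exp p z) + cmod (\<Sum>k<p. z ^ k / fact k)"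
    by (rule norm_triangle_ineq4)
  also have "cmod (\<Sum>k<p. z ^ k / fact k) \<le> (\<Sum>k<p. b k)"
    by (rule sum_norm_le) (simp add: b_def y_def norm_divide norm_power)
  finally show ?thesis
    using geom[of p] assms by simp
qed

text \<open>In terms of \<open>X = \<bar>z\<bar> ^ n / n!\<close>, the leading term is at least \<open>X / 3\<close>, because
  \<open>\<bar>n - z\<bar> \<le> 3 * n\<close>, and its error is at most \<open>1 + X / 6\<close>.\<close>

lemma stability_region_left_bound:
  assumes "10 \<le> p" "z \<in> stability_region p \<inter> left_half_plane"
  shows "cmod z ^ Suc p \<le> 12 * fact (Suc p)"
proof -
  define n where "n = Suc p"
  define X where "X = cmod z ^ n / (fact p * real n)"
  have E: "cmod (trunc_exp p z) \<le> 1" and Re: "Re z \<le> 0"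
    using assms by (auto simp: stability_region_def left_half_plane_def trunc_exp_def atMost_atLeast0)
  have z: "cmod z \<le> 2 * real p"
    using norm_trunc_exp_gt_1[of p z] E assms by linarith
  have n: "0 < real n" "11 \<le> real n" "2 * real p \<le> 2 * real n"
    using assms by (auto simp: n_def)
  have "real n \<le> cmod (of_nat n - z)"
    using Re by (rule Re_nonpos_imp_le_norm_diff)
  moreover have "cmod (of_nat n - z) \<le> 3 * real n"
    using norm_triangle_ineq4[of "of_nat n" z] z n by simp
  ultimately have "X / 3 \<le> cmod z ^ n / (fact p * cmod (of_nat n - z))"
    unfolding X_def divide_divide_eq_left using n
    by (intro divide_left_mono mult_pos_pos) (auto simp: algebra_simps)
  also have "\<dots> = cmod (z ^ n / (fact p * (of_nat n - z)))"
    by (simp add: norm_mult norm_divide norm_power)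
  also have "\<dots> \<le> cmod (trunc_exp p z + z ^ n / (fact p * (of_nat n - z))) + cmod (trunc_exp p z)"
    by (metis add_diff_cancel_left' norm_triangle_ineq4)
  also have "\<dots> \<le> 2 + cmod z ^ Suc n / (fact p * (real n)\<^sup>2 * real (Suc n))"
    using norm_trunc_exp_plus_leading_le[OF Re, of p] E by (simp add: n_def)
  also have "cmod z ^ Suc n / (fact p * (real n)\<^sup>2 * real (Suc n)) = X * (cmod z / (real n * real (Suc n)))"
    by (simp add: X_def power2_eq_square mult_ac)
  also have "\<dots> \<le> X * (1 / 6)"
  proof (rule mult_left_mono)
    have "cmod z * 6 \<le> real n * 12"
      using z n by simp
    also have "\<dots> \<le> real n * real (Suc n)"
      using n by (intro mult_left_mono) auto
    finally show "cmod z / (real n * real (Suc n)) \<le> 1 / 6"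
      using n by (subst pos_divide_le_eq) auto
  qed (simp add: X_def)
  finally have "X \<le> 12"
    by simp
  then show ?thesis
    using n by (simp add: X_def pos_divide_le_eq n_def[symmetric] mult_ac)
      (simp add: n_def mult_ac)
qed

text \<open>From \<open>n\<close> to \<open>n + 1\<close> the quotient of the two sides changes by the factor
  \<open>exp 1 * (1 - 1 / (n + 1)) ^ (n + 1)\<close>, which is at most 1 because \<open>1 - y \<le> exp (- y)\<close>.\<close>

lemma fact_mult_exp_le:
  assumes "1 \<le> n"
  shows "fact n * exp (real n) \<le> exp 1 * real n ^ Suc n"
  using assms
proof (induction n rule: dec_induct)
  case (step n)
  have "real n / real (Suc n) = 1 + (- 1 / real (Suc n))"
    by (simp add: field_simps)
  also have "\<dots> \<le> exp (- 1 / real (Suc n))"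
    by (rule exp_ge_add_one_self)
  finally have "(real n / real (Suc n)) ^ Suc n \<le> exp (- 1 / real (Suc n)) ^ Suc n"
    by (intro power_mono) auto
  also have "\<dots> = exp (- 1)"
    by (simp add: exp_of_nat_mult[symmetric] del: power_Suc of_nat_Suc)
  finally have le: "exp 1 * real n ^ Suc n \<le> real (Suc n) ^ Suc n"
    by (simp add: power_divide exp_minus field_simps del: power_Suc of_nat_Suc)
  have "fact (Suc n) * exp (real (Suc n)) = real (Suc n) * exp 1 * (fact n * exp (real n))"
    by (simp add: exp_add algebra_simps)
  also have "\<dots> \<le> real (Suc n) * exp 1 * (exp 1 * real n ^ Suc n)"
    using step.IH by (intro mult_left_mono) auto
  also have "\<dots> \<le> real (Suc n) * exp 1 * real (Suc n) ^ Suc n"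
    using le by (intro mult_left_mono) auto
  finally show ?case
    by (simp add: mult_ac)
qed simp

text \<open>Since \<open>fact n\<close> exceeds \<open>(n / e) ^ n\<close> only by a polynomial factor, the \<open>n\<close>-th root of
  \<open>12 * fact n\<close> is asymptotic to \<open>n / e\<close>.\<close>

lemma eventually_stability_region_left_subset_cball:
  assumes "c > exp (- 1)"
  shows "\<forall>\<^sub>F p in sequentially. \<forall>z\<in>stability_region p \<inter> left_half_plane. cmod z \<le> c * real p"
proof -
  define q where "q = c * exp 1"
  have q: "q > 1"
    using assms by (simp add: q_def exp_minus field_simps)
  have "\<forall>\<^sub>F p in sequentially. 12 * exp 1 * real (Suc p) < (q * real p / real (Suc p)) ^ Suc p"
    using q by real_asymp
  then show ?thesis
    using eventually_ge_at_top[of 10]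
  proof eventually_elim
    case (elim p)
    have "cmod z \<le> c * real p" if z: "z \<in> stability_region p \<inter> left_half_plane" for z
    proof (rule ccontr)
      assume "\<not> cmod z \<le> c * real p"
      moreover have "c \<ge> 0"
        using assms by (smt (verit) exp_gt_zero)
      ultimately have "(c * real p) ^ Suc p \<le> cmod z ^ Suc p"
        by (intro power_mono) auto
      also have "\<dots> \<le> 12 * fact (Suc p)"
        by (rule stability_region_left_bound) fact+
      finally have "(c * real p) ^ Suc p * exp (real (Suc p)) \<le> 12 * (fact (Suc p) * exp (real (Suc p)))"
        by (simp add: mult_right_mono del: power_Suc fact_Suc of_nat_Suc)
      also have "\<dots> \<le> 12 * (exp 1 * real (Suc p) ^ Suc (Suc p))"
        by (intro mult_left_mono fact_mult_exp_le) auto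
      finally have "(c * real p) ^ Suc p * exp (real (Suc p)) \<le>
          12 * (exp 1 * real (Suc p) ^ Suc (Suc p))" .
      moreover have "exp (real (Suc p)) = exp 1 ^ Suc p"
        using exp_of_nat_mult[of "Suc p" "1 :: real"] by simp
      ultimately have "(q * real p) ^ Suc p \<le> 12 * exp 1 * real (Suc p) * real (Suc p) ^ Suc p"
        by (simp add: q_def power_mult_distrib power_Suc[of _ "Suc p"] mult_ac del: of_nat_Suc power_Suc)
      then have "(q * real p / real (Suc p)) ^ Suc p \<le> 12 * exp 1 * real (Suc p)"
        by (simp add: power_divide divide_le_eq del: of_nat_Suc power_Suc)
      with elim show False
        by simp
    qed
    then show ?case by blast
  qed
qed

section \<open>The constant\<close>

lemma exp_Taylor_bounds:
  fixes x :: real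
  assumes "0 \<le> x" "x \<le> 1"
  shows "(\<Sum>k<n. x ^ k / fact k) \<le> exp x" "exp x \<le> (\<Sum>k<n. x ^ k / fact k) + 3 * x ^ n / fact n"
proof -
  obtain t where t: "\<bar>t\<bar> \<le> \<bar>x\<bar>" "exp x = (\<Sum>k<n. x ^ k / fact k) + exp t / fact n * x ^ n"
    using Maclaurin_exp_le by blast
  have "exp t \<le> 3"
    using t(1) assms exp_le by (smt (verit) exp_le_cancel_iff)
  then have "exp t / fact n * x ^ n \<le> 3 / fact n * x ^ n"
    using assms by (intro mult_right_mono divide_right_mono) auto
  then show "exp x \<le> (\<Sum>k<n. x ^ k / fact k) + 3 * x ^ n / fact n"
    using t(2) by simp
  show "(\<Sum>k<n. x ^ k / fact k) \<le> exp x"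
    using t(2) assms by simp
qed

lemma exp_minus_one_less: "exp (- 1) < (0.368 :: real)"
proof -
  have "2.718 \<le> exp (1 :: real)"
    using exp_Taylor_bounds(1)[of 1 8] by (simp add: lessThan_nat_numeral fact_numeral)
  then show ?thesis
    by (simp add: exp_minus field_simps)
qed

text \<open>For given \<open>w\<close> the base is minimal in \<open>x\<close> when \<open>tanh (w - tanh w + 1 / x) = x\<close>, and the optimal \<open>w\<close>
  then has \<open>sinh w = 0.368 / x\<close>. The solution is near \<open>x = 0.84\<close>, \<open>exp w = 1.53\<close>; rounding to
  \<open>x = 5 / 6\<close> and \<open>exp w = 3 / 2\<close> makes \<open>cosh w\<close> and \<open>tanh w\<close> rational and raises the base, about
  2.1565, only in the fourth decimal.\<close>

lemma growth_constant_le: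
  defines "x \<equiv> 5 / 6 :: real" and "w \<equiv> ln (3 / 2) :: real"
  shows "x * cosh (w - tanh w + 1 / x) * exp (0.368 / cosh w) \<le> 2.157"
proof -
  define E where "E = exp (53 / 65 :: real)"
  have E: "2.26 \<le> E" "E \<le> 2.2602"
    using exp_Taylor_bounds[of "53 / 65" 8]
    by (simp_all add: E_def lessThan_nat_numeral fact_numeral field_simps)
  have w: "cosh w = 13 / 12" "tanh w = 5 / 13"
    by (simp_all add: w_def cosh_ln_real tanh_ln_real power2_eq_square)
  have R: "exp (0.368 / cosh w) \<le> 1.4046"
    using exp_Taylor_bounds(2)[of "0.368 * 12 / 13" 6]
    by (simp add: w lessThan_nat_numeral fact_numeral field_simps)
  have "w - tanh w + 1 / x = w + 53 / 65"
    by (simp add: w x_def)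
  moreover have "exp (w + 53 / 65) = 3 / 2 * E"
    by (simp add: exp_add E_def w_def)
  ultimately have "exp (w - tanh w + 1 / x) = 3 / 2 * E"
    by metis
  then have "cosh (w - tanh w + 1 / x) = (3 / 2 * E + inverse (3 / 2 * E)) / 2"
    by (simp only: cosh_def exp_minus) simp
  moreover have "inverse (3 / 2 * E) \<le> inverse 3.39"
    using E by (intro le_imp_inverse_le) auto
  ultimately have C: "cosh (w - tanh w + 1 / x) \<le> 1.8428"
    using E by simp
  have "x * cosh (w - tanh w + 1 / x) * exp (0.368 / cosh w) \<le> x * 1.8428 * 1.4046"
    using C R by (intro mult_mono) (auto simp: x_def)
  then show ?thesis
    by (simp add: x_def)
qed

section \<open>Growth of the amplification factor\<close>

lemma em_M_le:
  assumes "0 < x" "0 < w" "0 < r" "\<And>z. z \<in> S \<Longrightarrow> cmod z \<le> c * real (2 * r)"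
  shows "em_M (2 * r) S \<le> ereal (2 * (x * cosh (w - tanh w + 1 / x) * exp (c / cosh w)) ^ (2 * r))"
proof -
  have "cmod (poly (em_Q (2 * r) m l) z) \<le> 2 * (x * cosh (w - tanh w + 1 / x) * exp (c / cosh w)) ^ (2 * r)"
    if "m \<in> {1..r}" "l \<in> {1..2 * m}" "z \<in> S" for m l z
  proof -
    have "cmod (poly (em_Q (2 * r) m l) z) \<le>
        2 * (x * cosh (w - tanh w + 1 / x)) ^ (2 * r) * exp (cmod z / cosh w)"
      using assms(1,2) that by (intro norm_em_Q_le) auto
    also have "\<dots> \<le> 2 * (x * cosh (w - tanh w + 1 / x)) ^ (2 * r) * exp (c * real (2 * r) / cosh w)"
      using assms that(3) by (intro mult_left_mono) (auto intro!: divide_right_mono)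
    also have "exp (c * real (2 * r) / cosh w) = exp (c / cosh w) ^ (2 * r)"
      by (simp add: exp_of_nat_mult[symmetric] mult.commute)
    finally show ?thesis
      by (simp add: power_mult_distrib mult.assoc)
  qed
  then show ?thesis
    unfolding em_M_def using assms(3) by (auto intro!: SUP_least)
qed

theorem theorem4p24:
  fixes \<epsilon> :: real
  assumes "\<epsilon> > 0"
  shows "\<exists>p\<^sub>0 :: nat. p\<^sub>0 > 0 \<and>
    (\<forall>p :: nat. p \<ge> p\<^sub>0 \<longrightarrow> even p \<longrightarrow>
      em_M p (stability_region p \<inter> left_half_plane)
        < ereal ((2.157 + \<epsilon>) ^ p / (pi * sqrt (real p - 1))))"
proof -
  define x where "x = (5 / 6 :: real)"
  define w where "w = ln (3 / 2 :: real)"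
  define K where "K = x * cosh (w - tanh w + 1 / x) * exp (0.368 / cosh w)"
  have xw: "0 < x" "0 < w"
    by (auto simp: x_def w_def)
  have "\<forall>\<^sub>F p :: nat in sequentially. 2 * 2.157 ^ p < (2.157 + \<epsilon>) ^ p / (pi * sqrt (real p - 1))"
    using assms by real_asymp
  then have "\<forall>\<^sub>F p in sequentially. even p \<longrightarrow>
      em_M p (stability_region p \<inter> left_half_plane) < ereal ((2.157 + \<epsilon>) ^ p / (pi * sqrt (real p - 1)))"
    using eventually_stability_region_left_subset_cball[OF exp_minus_one_less] eventually_gt_at_top[of 0]
  proof eventually_elim
    case (elim p)
    show ?case
    proof
      assume "even p"
      then obtain r where r: "p = 2 * r"
        by (elim evenE)
      have "em_M p (stability_region p \<inter> left_half_plane) \<le> ereal (2 * K ^ p)"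
        unfolding K_def r using elim xw by (intro em_M_le) (auto simp: r)
      also have "2 * K ^ p \<le> 2 * 2.157 ^ p"
        using growth_constant_le xw unfolding K_def x_def w_def
        by (intro mult_left_mono power_mono) auto
      also have "\<dots> < (2.157 + \<epsilon>) ^ p / (pi * sqrt (real p - 1))"
        by (rule elim)
      finally show "em_M p (stability_region p \<inter> left_half_plane) <
          ereal ((2.157 + \<epsilon>) ^ p / (pi * sqrt (real p - 1)))"
        by simp
    qed
  qed
  then obtain N where "\<forall>p\<ge>N. even p \<longrightarrow>
      em_M p (stability_region p \<inter> left_half_plane) < ereal ((2.157 + \<epsilon>) ^ p / (pi * sqrt (real p - 1)))"
    unfolding eventually_sequentially by blast
  then show ?thesis
    by (intro exI[of _ "Suc N"]) auto
qed

end
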